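(* Let $\Lambda=(V,E)$ be a finite graph, let $\mathbf{N}:E\to\mathbb{Z}_{\geq0}$, and let $f,g:V\to\mathbb{Z}$ satisfy $\sum_{v\in V}f(v)=\sum_{v\in V}g(v)=0$. Then the map $$F:\{\partial\mathbf{r}=f,\ \partial\mathbf{b}=g\}_{\mathbf{N}}\to\{\partial\mathbf{r}=f+g\}_{\mathbf{N}}\times\{\partial\mathbf{b}=-f+g\}_{\mathbf{N}},\qquad \omega\mapsto(\omega_{\tt R},\omega_{\tt B}),$$ is well defined and is a bijection, where $\omega_{\tt R}$ is obtained from $\omega$ by keeping all orientations and painting all edges red, and $\omega_{\tt B}$ is obtained from $\omega$ by keeping the orientations of the blue edges, reversing the orientations of the red edges, and painting all edges blue. Consequently, $$\#\{\partial\mathbf{r}=f,\ \partial\mathbf{b}=g\}_{\mathbf{N}}=\#\{\partial\mathbf{r}=f+g\}_{\mathbf{N}}\cdot\#\{\partial\mathbf{b}=-f+g\}_{\mathbf{N}}.$$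
   Context: $\mathbb{G}_{\mathbf{N}}$ denotes the unoriented multigraph on the vertex set $V$ which, for each $xy\in E$, has exactly $\mathbf{N}_{xy}$ distinguishable edges connecting $x$ and $y$ (and no other edges). A two-colored oriented configuration on $\mathbb{G}_{\mathbf{N}}$ is an assignment, to each edge of $\mathbb{G}_{\mathbf{N}}$, of an orientation (one of the two directions) and a color (red or blue). For such a configuration and for each edge $xy\in E$, $\mathbf{r}_{\vec{xy}}$ (resp. $\mathbf{b}_{\vec{xy}}$) denotes the number of red (resp. blue) edges oriented from $x$ to $y$. For a function $\mathbf{n}$ from the set of oriented edges of $\Lambda$ to $\mathbb{Z}_{\geq0}$, the source function $\partial\mathbf{n}:V\to\mathbb{Z}$ is $$\partial\mathbf{n}_x=\sum_{y\in V:\,y\sim x}\left(\mathbf{n}_{\vec{xy}}-\mathbf{n}_{\vec{yx}}\right).$$ $\{\partial\mathbf{r}=f,\ \partial\mathbf{b}=g\}_{\mathbf{N}}$ is the set of all two-colored oriented configurations on $\mathbb{G}_{\mathbf{N}}$ with $\partial\mathbf{r}=f$ and $\partial\mathbf{b}=g$. For $h:V\to\mathbb{Z}$, $\{\partial\mathbf{r}=h\}_{\mathbf{N}}$ (resp. $\{\partial\mathbf{b}=h\}_{\mathbf{N}}$) is the set of configurations in which every edge of $\mathbb{G}_{\mathbf{N}}$ is given an orientation and is painted red (resp. blue), and whose source function is $h$. The symbol $\#$ denotes cardinality. *)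

theory Defs
  imports Main "HOL-Library.FuncSet"
begin

definition simple_graph :: "'v set \<Rightarrow> 'v set set \<Rightarrow> bool" where
  "simple_graph V E \<longleftrightarrow> (\<forall>e\<in>E. e \<subseteq> V \<and> card e = 2)"

datatype color = Red | Blue

text \<open>A multigraph edge is a pair \<open>(e, i)\<close>, the \<open>i\<close>-th of the \<open>N e\<close> copies of \<open>e\<close>.\<close>

definition multi_edges :: "'v set set \<Rightarrow> ('v set \<Rightarrow> nat) \<Rightarrow> ('v set \<times> nat) set" where
  "multi_edges E N = (SIGMA e:E. {..<N e})"

text \<open>The pair \<open>(x, y)\<close> stands for the direction from \<open>x\<close> to \<open>y\<close>.\<close>

definition orientations :: "'v set \<Rightarrow> ('v \<times> 'v) set" where
  "orientations e = {(x, y). {x, y} = e}"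

type_synonym 'v config = "'v set \<times> nat \<Rightarrow> ('v \<times> 'v) \<times> color"

text \<open>The extensional function space makes configurations that agree on all edges equal.\<close>

definition configs :: "'v set set \<Rightarrow> ('v set \<Rightarrow> nat) \<Rightarrow> 'v config set" where
  "configs E N = (\<Pi>\<^sub>E m\<in>multi_edges E N. orientations (fst m) \<times> UNIV)"

definition color_count ::
    "'v set set \<Rightarrow> ('v set \<Rightarrow> nat) \<Rightarrow> color \<Rightarrow> 'v config \<Rightarrow> 'v \<Rightarrow> 'v \<Rightarrow> nat" where
  "color_count E N c \<omega> x y = card {m \<in> multi_edges E N. \<omega> m = ((x, y), c)}"

definition source :: "'v set \<Rightarrow> 'v set set \<Rightarrow> ('v \<Rightarrow> 'v \<Rightarrow> nat) \<Rightarrow> 'v \<Rightarrow> int" where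
  "source V E n x = (\<Sum>y | y \<in> V \<and> {x, y} \<in> E. int (n x y) - int (n y x))"

definition two_color_configs ::
    "'v set \<Rightarrow> 'v set set \<Rightarrow> ('v set \<Rightarrow> nat) \<Rightarrow> ('v \<Rightarrow> int) \<Rightarrow> ('v \<Rightarrow> int) \<Rightarrow> 'v config set" where
  "two_color_configs V E N f g =
    {\<omega> \<in> configs E N.
      (\<forall>x\<in>V. source V E (color_count E N Red \<omega>) x = f x) \<and>
      (\<forall>x\<in>V. source V E (color_count E N Blue \<omega>) x = g x)}"

definition one_color_configs ::
    "'v set \<Rightarrow> 'v set set \<Rightarrow> ('v set \<Rightarrow> nat) \<Rightarrow> color \<Rightarrow> ('v \<Rightarrow> int) \<Rightarrow> 'v config set" where
  "one_color_configs V E N c h =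
    {\<omega> \<in> configs E N.
      (\<forall>m\<in>multi_edges E N. snd (\<omega> m) = c) \<and>
      (\<forall>x\<in>V. source V E (color_count E N c \<omega>) x = h x)}"

definition paint_red :: "'v set set \<Rightarrow> ('v set \<Rightarrow> nat) \<Rightarrow> 'v config \<Rightarrow> 'v config" where
  "paint_red E N \<omega> = (\<lambda>m\<in>multi_edges E N. (fst (\<omega> m), Red))"

definition reverse_red_paint_blue :: "'v set set \<Rightarrow> ('v set \<Rightarrow> nat) \<Rightarrow> 'v config \<Rightarrow> 'v config" where
  "reverse_red_paint_blue E N \<omega> =
    (\<lambda>m\<in>multi_edges E N.
      (if snd (\<omega> m) = Red then prod.swap (fst (\<omega> m)) else fst (\<omega> m), Blue))"

definition switching_map ::
    "'v set set \<Rightarrow> ('v set \<Rightarrow> nat) \<Rightarrow> 'v config \<Rightarrow> 'v config \<times> 'v config" where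
  "switching_map E N \<omega> = (paint_red E N \<omega>, reverse_red_paint_blue E N \<omega>)"

end

(* The source of a configuration is linear in its edge counts, so painting everything red gives
   source f + g, and reversing the red edges flips the sign of their contribution and gives
   -f + g. Both steps can be undone: an edge of the original configuration was blue exactly when
   its orientations in the two images agree, because an edge between distinct vertices differs
   from its reversal. *)

theory Submission
  imports Defs
begin

text \<open>Separates the bijection from the source conditions: it can be proved on all
  configurations first and then cut down on both sides at once. Surjectivity survives because the
  preimage in \<open>C\<close> of a point of \<open>T\<close> is forced into \<open>A\<close> by the
  equivalence.\<close>

lemma bij_betw_restrict_target:
  assumes "bij_betw h C M" and "T \<subseteq> M" and "A \<subseteq> C"
    and "\<And>x. x \<in> C \<Longrightarrow> x \<in> A \<longleftrightarrow> h x \<in> T"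
  shows "bij_betw h A T"
proof -
  have "h ` A = T"
  proof (intro equalityI subsetI)
    show "y \<in> T" if "y \<in> h ` A" for y
      using that assms(3,4) by auto
    show "y \<in> h ` A" if "y \<in> T" for y
    proof -
      have "y \<in> h ` C"
        using that assms(2) bij_betw_imp_surj_on[OF assms(1)] by auto
      with that assms(4) show ?thesis
        by auto
    qed
  qed
  with assms(1,3) show ?thesis
    by (rule bij_betw_subset)
qed

lemma finite_multi_edges:
  assumes "finite V" and "simple_graph V E"
  shows "finite (multi_edges E N)"
proof -
  have "E \<subseteq> Pow V"
    using assms(2) by (auto simp: simple_graph_def)
  then have "finite E"
    using assms(1) finite_subset by blast
  then show ?thesis
    by (simp add: multi_edges_def)
qed

lemma color_count_paint_red:
  assumes "finite (multi_edges E N)"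
  shows "color_count E N Red (paint_red E N \<omega>) x y =
    color_count E N Red \<omega> x y + color_count E N Blue \<omega> x y"
proof -
  let ?S = "\<lambda>c. {m \<in> multi_edges E N. \<omega> m = ((x, y), c)}"
  have "{m \<in> multi_edges E N. paint_red E N \<omega> m = ((x, y), Red)} = ?S Red \<union> ?S Blue"
  proof (intro set_eqI)
    show "m \<in> {m \<in> multi_edges E N. paint_red E N \<omega> m = ((x, y), Red)} \<longleftrightarrow>
        m \<in> ?S Red \<union> ?S Blue" for m
      by (cases "snd (\<omega> m)") (auto simp: paint_red_def prod_eq_iff)
  qed
  moreover have "card (?S Red \<union> ?S Blue) = card (?S Red) + card (?S Blue)"
    using assms by (intro card_Un_disjoint) auto
  ultimately show ?thesis
    by (simp add: color_count_def)
qed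

text \<open>The red edges contributing from \<open>x\<close> to \<open>y\<close> are those that
  pointed from \<open>y\<close> to \<open>x\<close> before the reversal, hence the exchanged
  arguments. The two classes differ in color, so their cardinalities add.\<close>

lemma color_count_reverse_red_paint_blue:
  assumes "finite (multi_edges E N)"
  shows "color_count E N Blue (reverse_red_paint_blue E N \<omega>) x y =
    color_count E N Red \<omega> y x + color_count E N Blue \<omega> x y"
proof -
  let ?R = "{m \<in> multi_edges E N. \<omega> m = ((y, x), Red)}"
  let ?B = "{m \<in> multi_edges E N. \<omega> m = ((x, y), Blue)}"
  have "{m \<in> multi_edges E N. reverse_red_paint_blue E N \<omega> m = ((x, y), Blue)} = ?R \<union> ?B"
  proof (intro set_eqI)
    show "m \<in> {m \<in> multi_edges E N. reverse_red_paint_blue E N \<omega> m = ((x, y), Blue)} \<longleftrightarrow>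
        m \<in> ?R \<union> ?B" for m
      by (cases "snd (\<omega> m)") (auto simp: reverse_red_paint_blue_def prod_eq_iff)
  qed
  moreover have "card (?R \<union> ?B) = card ?R + card ?B"
    using assms by (intro card_Un_disjoint) auto
  ultimately show ?thesis
    by (simp add: color_count_def)
qed

lemma source_paint_red:
  assumes "finite (multi_edges E N)"
  shows "source V E (color_count E N Red (paint_red E N \<omega>)) x =
    source V E (color_count E N Red \<omega>) x + source V E (color_count E N Blue \<omega>) x"
  by (simp add: source_def color_count_paint_red[OF assms] sum.distrib sum_subtractf)

text \<open>The sign arises because each summand of \<open>source\<close> is antisymmetric in the
  two endpoints, which the red count has exchanged.\<close>

lemma source_reverse_red_paint_blue:
  assumes "finite (multi_edges E N)"
  shows "source V E (color_count E N Blue (reverse_red_paint_blue E N \<omega>)) x =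
    - source V E (color_count E N Red \<omega>) x + source V E (color_count E N Blue \<omega>) x"
  by (simp add: source_def color_count_reverse_red_paint_blue[OF assms] sum.distrib
      sum_subtractf)

text \<open>At each vertex the red and blue sources solve a linear system with rows (1, 1) and (-1,
  1). Its determinant is 2, so \<open>f x\<close> and \<open>g x\<close> form the only solution. The
  backward direction later yields surjectivity.\<close>

lemma two_color_configs_iff_switching:
  assumes "finite (multi_edges E N)"
  shows "\<omega> \<in> two_color_configs V E N f g \<longleftrightarrow>
    \<omega> \<in> configs E N \<and>
    (\<forall>x\<in>V. source V E (color_count E N Red (paint_red E N \<omega>)) x = f x + g x) \<and>
    (\<forall>x\<in>V. source V E (color_count E N Blue (reverse_red_paint_blue E N \<omega>)) x = - f x + g x)"
proof -
  have "source V E (color_count E N Red \<omega>) x = f x \<and>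
      source V E (color_count E N Blue \<omega>) x = g x \<longleftrightarrow>
    source V E (color_count E N Red (paint_red E N \<omega>)) x = f x + g x \<and>
      source V E (color_count E N Blue (reverse_red_paint_blue E N \<omega>)) x = - f x + g x" for x
    unfolding source_paint_red[OF assms] source_reverse_red_paint_blue[OF assms] by linarith
  then show ?thesis
    by (simp only: two_color_configs_def mem_Collect_eq flip: ball_conj_distrib)
qed

lemma swap_in_orientations: "p \<in> orientations e \<Longrightarrow> prod.swap p \<in> orientations e"
  by (auto simp: orientations_def)

text \<open>Only a loop \<open>(a, a)\<close> is fixed by the swap, and its edge would be a
  singleton.\<close>

lemma orientations_neq_swap:
  assumes "card e = 2" and "p \<in> orientations e"
  shows "p \<noteq> prod.swap p"
  using assms by (cases p) (auto simp: orientations_def)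

lemma orientations_eq_or_swap:
  assumes "p \<in> orientations e" and "q \<in> orientations e"
  shows "q = p \<or> q = prod.swap p"
proof -
  obtain a b c d where pq: "p = (a, b)" "q = (c, d)"
    by (cases p, cases q)
  then have "{c, d} = {a, b}"
    using assms by (simp add: orientations_def)
  then show ?thesis
    by (simp add: pq doubleton_eq_iff)
qed

text \<open>The one-color configurations before any source is prescribed.\<close>

definition monochromatic_configs :: "'v set set \<Rightarrow> ('v set \<Rightarrow> nat) \<Rightarrow> color \<Rightarrow> 'v config set" where
  "monochromatic_configs E N c = {\<omega> \<in> configs E N. \<forall>m\<in>multi_edges E N. snd (\<omega> m) = c}"

text \<open>The inverse of \<open>switching_map\<close>: the red configuration retains every
  original direction, and comparison with the blue one recovers the color.\<close>

definition unswitch ::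
    "'v set set \<Rightarrow> ('v set \<Rightarrow> nat) \<Rightarrow> 'v config \<times> 'v config \<Rightarrow> 'v config" where
  "unswitch E N = (\<lambda>(\<rho>, \<beta>). \<lambda>m\<in>multi_edges E N.
    (fst (\<rho> m), if fst (\<beta> m) = fst (\<rho> m) then Blue else Red))"

lemma fst_config_in_orientations:
  assumes "\<omega> \<in> configs E N" and "m \<in> multi_edges E N"
  shows "fst (\<omega> m) \<in> orientations (fst m)"
  using PiE_mem[OF assms(1)[unfolded configs_def] assms(2)] by (simp add: mem_Times_iff)

lemma config_outside:
  assumes "\<omega> \<in> configs E N" and "m \<notin> multi_edges E N"
  shows "\<omega> m = undefined"
  using PiE_arb[OF assms(1)[unfolded configs_def] assms(2)] .

lemma restrict_in_configs:
  assumes "\<And>m. m \<in> multi_edges E N \<Longrightarrow> fst (h m) \<in> orientations (fst m)"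
  shows "restrict h (multi_edges E N) \<in> configs E N"
  unfolding configs_def using assms by (intro restrict_PiE_iff[THEN iffD2]) (simp add: mem_Times_iff)

text \<open>The map acts on each edge separately, matching its four states (two directions, two
  colors) with the four pairs of directions.\<close>

lemma bij_betw_switching_map:
  assumes "simple_graph V E"
  shows "bij_betw (switching_map E N) (configs E N)
    (monochromatic_configs E N Red \<times> monochromatic_configs E N Blue)"
proof (rule bij_betwI[where g = "unswitch E N"])
  have card: "card (fst m) = 2" if "m \<in> multi_edges E N" for m
    using that assms by (auto simp: multi_edges_def simple_graph_def)
  show "switching_map E N \<in> configs E N \<rightarrow>
      monochromatic_configs E N Red \<times> monochromatic_configs E N Blue"
    by (simp add: switching_map_def monochromatic_configs_def paint_red_def
        reverse_red_paint_blue_def restrict_in_configs swap_in_orientations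
        fst_config_in_orientations)
  show "unswitch E N \<in>
      monochromatic_configs E N Red \<times> monochromatic_configs E N Blue \<rightarrow> configs E N"
    by (auto simp: unswitch_def monochromatic_configs_def restrict_in_configs
        fst_config_in_orientations)
  show "unswitch E N (switching_map E N \<omega>) = \<omega>" if \<omega>: "\<omega> \<in> configs E N" for \<omega>
  proof
    fix m
    show "unswitch E N (switching_map E N \<omega>) m = \<omega> m"
    proof (cases "m \<in> multi_edges E N")
      case True
      \<comment> \<open>Otherwise a red edge would agree with its reversal and be decoded as
        blue.\<close>
      then have "prod.swap (fst (\<omega> m)) \<noteq> fst (\<omega> m)"
        using orientations_neq_swap[OF card] fst_config_in_orientations[OF \<omega>] by metis
      with True show ?thesis
        by (cases "snd (\<omega> m)") (auto simp: unswitch_def switching_map_def paint_red_def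
            reverse_red_paint_blue_def prod_eq_iff)
    next
      case False
      \<comment> \<open>Both sides take the default value \<open>undefined\<close> off the edge
        set.\<close>
      with \<omega> show ?thesis
        by (auto simp: unswitch_def switching_map_def config_outside)
    qed
  qed
  show "switching_map E N (unswitch E N p) = p"
    if "p \<in> monochromatic_configs E N Red \<times> monochromatic_configs E N Blue" for p
  proof -
    obtain \<rho> \<beta> where p: "p = (\<rho>, \<beta>)"
      and \<rho>: "\<rho> \<in> configs E N" "\<And>m. m \<in> multi_edges E N \<Longrightarrow> snd (\<rho> m) = Red"
      and \<beta>: "\<beta> \<in> configs E N" "\<And>m. m \<in> multi_edges E N \<Longrightarrow> snd (\<beta> m) = Blue"
      using \<open>p \<in> _\<close> by (auto simp: monochromatic_configs_def)
    have "paint_red E N (unswitch E N (\<rho>, \<beta>)) m = \<rho> m" for m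
      using \<rho> by (cases "m \<in> multi_edges E N")
        (auto simp: paint_red_def unswitch_def prod_eq_iff config_outside)
    moreover have "reverse_red_paint_blue E N (unswitch E N (\<rho>, \<beta>)) m = \<beta> m" for m
    proof (cases "m \<in> multi_edges E N")
      case True
      \<comment> \<open>If the directions differ, the edge is decoded as red with the direction of
        \<open>\<rho>\<close>; reversing it gives that of \<open>\<beta>\<close> because no third
        direction exists.\<close>
      then have "fst (\<beta> m) = fst (\<rho> m) \<or> fst (\<beta> m) = prod.swap (fst (\<rho> m))"
        using orientations_eq_or_swap fst_config_in_orientations \<rho>(1) \<beta>(1) by metis
      with True \<beta>(2) show ?thesis
        by (auto simp: reverse_red_paint_blue_def unswitch_def prod_eq_iff)
    next
      case False
      with \<beta>(1) show ?thesis
        by (auto simp: reverse_red_paint_blue_def config_outside)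
    qed
    ultimately show ?thesis
      by (auto simp: switching_map_def p)
  qed
qed

theorem mainTheorem2:
  fixes V :: "'v set" and E :: "'v set set" and N :: "'v set \<Rightarrow> nat"
    and f g :: "'v \<Rightarrow> int"
  assumes "finite V" and "simple_graph V E"
    and "(\<Sum>v\<in>V. f v) = 0" and "(\<Sum>v\<in>V. g v) = 0"
  shows "switching_map E N \<in> two_color_configs V E N f g \<rightarrow>
      one_color_configs V E N Red (\<lambda>x. f x + g x) \<times>
      one_color_configs V E N Blue (\<lambda>x. - f x + g x)
    \<and> bij_betw (switching_map E N) (two_color_configs V E N f g)
      (one_color_configs V E N Red (\<lambda>x. f x + g x) \<times>
       one_color_configs V E N Blue (\<lambda>x. - f x + g x))
    \<and> card (two_color_configs V E N f g) =
      card (one_color_configs V E N Red (\<lambda>x. f x + g x)) *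
      card (one_color_configs V E N Blue (\<lambda>x. - f x + g x))"
proof -
  let ?A = "two_color_configs V E N f g"
  let ?R = "one_color_configs V E N Red (\<lambda>x. f x + g x)"
  let ?B = "one_color_configs V E N Blue (\<lambda>x. - f x + g x)"
  let ?M = "monochromatic_configs E N Red \<times> monochromatic_configs E N Blue"
  note fin = finite_multi_edges[OF assms(1,2)]
  note bij = bij_betw_switching_map[OF assms(2), of N]
  \<comment> \<open>The image of any configuration already has the right colors, so only the source
    conditions remain to be compared.\<close>
  have mem: "\<omega> \<in> ?A \<longleftrightarrow> switching_map E N \<omega> \<in> ?R \<times> ?B" if "\<omega> \<in> configs E N" for \<omega>
  proof -
    have "switching_map E N \<omega> \<in> ?M"
      using that bij by (auto simp: bij_betw_def)
    with that show ?thesis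
      by (simp add: two_color_configs_iff_switching[OF fin] switching_map_def
          one_color_configs_def monochromatic_configs_def)
  qed
  have sub: "?A \<subseteq> configs E N"
    by (auto simp: two_color_configs_def)
  have "?R \<times> ?B \<subseteq> ?M"
    by (auto simp: one_color_configs_def monochromatic_configs_def)
  then have main: "bij_betw (switching_map E N) ?A (?R \<times> ?B)"
    by (rule bij_betw_restrict_target[OF bij _ sub mem])
  have "card ?A = card ?R * card ?B"
    using bij_betw_same_card[OF main] by (simp only: card_cartesian_product)
  with main bij_betw_imp_funcset[OF main] show ?thesis
    by (intro conjI)
qed

end
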